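(* Let $r,n,k,s,q\geq 1$ be integers with $\gcd(n,6)=1$ and $r\geq s$. If the Prishchepov group $P(r,n,k,s,q)$ is perfect, then it is either trivially perfect or of type $\widetilde{\mathfrak Z}$.
   Context: For $n\ge 1$ let $F_n$ be the free group on $x_0,\dots,x_{n-1}$ and let $\theta\in\operatorname{Aut}(F_n)$ be given by $\theta(x_i)=x_{(i+1)\bmod n}$. For $w\in F_n$, $G_n(w)$ is the group with presentation $\langle x_0,\dots,x_{n-1}\mid w,\theta(w),\dots,\theta^{n-1}(w)\rangle$. For integers $r,n,k,s,q\ge 1$, the Prishchepov group is $P(r,n,k,s,q)=G_n(w)$ with $$w=\Bigl(\prod_{i=0}^{r-1}x_{iq}\Bigr)\Bigl(\prod_{i=0}^{s-1}x_{k-1+iq}\Bigr)^{-1},$$ subscripts taken modulo $n$, and products written in order of increasing $i$. A group is perfect if its abelianisation is trivial. $P(r,n,k,s,q)$ is called trivially perfect if $|r-s|=1$ and at least one of the following congruences holds modulo $n$: $k\equiv 1$; $k\equiv 1+q$; $\gcd(q,n)\,r\equiv 0$; $\gcd(q,n)\,s\equiv 0$. (This is a condition on the parameters.) $P(r,n,k,s,q)$ is said to be of type $\widetilde{\mathfrak Z}$ if $q(r-s)\equiv 2(k-1)\pmod n$ or $q(r+s)\equiv 0\pmod n$. (This is a condition on the parameters.) *)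

theory Defs
  imports
    "HOL-Algebra.Generated_Groups"
    "HOL-Algebra.Elementary_Groups"
    "HOL-Number_Theory.Cong"
begin

section \<open>Free groups of finite rank\<close>

text \<open>
  The free group on \<open>x\<^sub>0, \<dots>, x\<^sub>n\<^sub>-\<^sub>1\<close> is realised on freely reduced words; the letter \<open>(i, True)\<close>
  stands for \<open>x\<^sub>i\<close> and \<open>(i, False)\<close> for its inverse.
\<close>

type_synonym letter = "nat \<times> bool"

definition linv :: "letter \<Rightarrow> letter" where
  "linv a = (fst a, \<not> snd a)"

definition reduced :: "letter list \<Rightarrow> bool" where
  "reduced w \<longleftrightarrow> successively (\<lambda>a b. b \<noteq> linv a) w"

fun push :: "letter \<Rightarrow> letter list \<Rightarrow> letter list" where
  "push a [] = [a]"
| "push a (b # w) = (if b = linv a then w else a # b # w)"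

text \<open>For reduced \<open>v\<close>, \<open>foldr push u v\<close> is the free reduction of the concatenation of \<open>u\<close> and \<open>v\<close>.\<close>

definition free_group :: "nat \<Rightarrow> letter list monoid" where
  "free_group n =
    \<lparr>carrier = {w. fst ` set w \<subseteq> {..<n} \<and> reduced w}, monoid.mult = foldr push, one = []\<rparr>"

definition free_gen :: "nat \<Rightarrow> letter list" where
  "free_gen i = [(i, True)]"


section \<open>Cyclically presented groups\<close>

definition normal_closure :: "('a, 'b) monoid_scheme \<Rightarrow> 'a set \<Rightarrow> 'a set" where
  "normal_closure G R = \<Inter>{N. N \<lhd> G \<and> R \<subseteq> N}"

definition presented_group :: "nat \<Rightarrow> letter list set \<Rightarrow> letter list set monoid" where
  "presented_group n R = free_group n Mod normal_closure (free_group n) R"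

text \<open>
  The shift permutes the generators, hence maps reduced words to reduced words letter by letter;
  see \<open>shift_iso\<close> and \<open>shift_free_gen\<close> below.
\<close>

definition shift :: "nat \<Rightarrow> letter list \<Rightarrow> letter list" where
  "shift n = map (\<lambda>(i, e). ((i + 1) mod n, e))"

definition cyclically_presented_group :: "nat \<Rightarrow> letter list \<Rightarrow> letter list set monoid" where
  "cyclically_presented_group n w = presented_group n {(shift n ^^ j) w | j. j < n}"


section \<open>Prishchepov groups\<close>

definition list_mult :: "('a, 'b) monoid_scheme \<Rightarrow> 'a list \<Rightarrow> 'a" where
  "list_mult G xs = foldr (\<otimes>\<^bsub>G\<^esub>) xs \<one>\<^bsub>G\<^esub>"

definition Prishchepov_word :: "nat \<Rightarrow> nat \<Rightarrow> nat \<Rightarrow> nat \<Rightarrow> nat \<Rightarrow> letter list" where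
  "Prishchepov_word r n k s q =
    list_mult (free_group n) (map (\<lambda>i. free_gen (i * q mod n)) [0..<r])
    \<otimes>\<^bsub>free_group n\<^esub>
    inv\<^bsub>free_group n\<^esub>
      list_mult (free_group n) (map (\<lambda>i. free_gen ((k - 1 + i * q) mod n)) [0..<s])"

definition Prishchepov_group :: "nat \<Rightarrow> nat \<Rightarrow> nat \<Rightarrow> nat \<Rightarrow> nat \<Rightarrow> letter list set monoid" where
  "Prishchepov_group r n k s q = cyclically_presented_group n (Prishchepov_word r n k s q)"

definition abelianisation :: "('a, 'b) monoid_scheme \<Rightarrow> 'a set monoid" where
  "abelianisation G = G Mod derived G (carrier G)"

definition perfect_group :: "('a, 'b) monoid_scheme \<Rightarrow> bool" where
  "perfect_group G \<longleftrightarrow> trivial_group (abelianisation G)"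

definition trivially_perfect :: "nat \<Rightarrow> nat \<Rightarrow> nat \<Rightarrow> nat \<Rightarrow> nat \<Rightarrow> bool" where
  "trivially_perfect r n k s q \<longleftrightarrow>
    \<bar>int r - int s\<bar> = 1 \<and>
    ([k = 1] (mod n) \<or> [k = 1 + q] (mod n) \<or>
     [gcd q n * r = 0] (mod n) \<or> [gcd q n * s = 0] (mod n))"

definition type_Z_tilde :: "nat \<Rightarrow> nat \<Rightarrow> nat \<Rightarrow> nat \<Rightarrow> nat \<Rightarrow> bool" where
  "type_Z_tilde r n k s q \<longleftrightarrow>
    [int q * (int r - int s) = 2 * (int k - 1)] (mod int n) \<or>
    [q * (r + s) = 0] (mod n)"


section \<open>Well-definedness\<close>

lemma linv_linv [simp]: "linv (linv a) = a"
  by (simp add: linv_def)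

lemma fst_linv [simp]: "fst (linv a) = fst a"
  by (simp add: linv_def)

lemma linv_neq [simp]: "linv a \<noteq> a" "a \<noteq> linv a"
  by (cases a; simp add: linv_def)+

lemma reduced_Nil [simp]: "reduced []"
  by (simp add: reduced_def)

lemma reduced_Cons: "reduced (a # w) \<longleftrightarrow> reduced w \<and> (w = [] \<or> hd w \<noteq> linv a)"
  by (cases w) (auto simp: reduced_def)

lemma reduced_push: "reduced w \<Longrightarrow> reduced (push a w)"
  by (cases w) (auto simp: reduced_Cons)

lemma push_linv: "reduced w \<Longrightarrow> push a (push (linv a) w) = w"
proof (cases w)
  case (Cons b v)
  assume "reduced w"
  then show ?thesis by (cases v) (auto simp: Cons reduced_Cons)
qed simp

lemma push_reduced_Cons: "reduced (a # w) \<Longrightarrow> push a w = a # w"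
  by (cases w) (auto simp: reduced_Cons)

lemma reduced_foldr_push: "reduced v \<Longrightarrow> reduced (foldr push u v)"
  by (induction u) (auto intro: reduced_push)

lemma foldr_push_Nil: "reduced u \<Longrightarrow> foldr push u [] = u"
  by (induction u) (auto simp: reduced_Cons push_reduced_Cons)

lemma foldr_push_push:
  "reduced w \<Longrightarrow> foldr push (push a t) w = push a (foldr push t w)"
  by (cases t) (auto simp: push_linv reduced_foldr_push)

lemma foldr_push_assoc:
  "reduced w \<Longrightarrow> foldr push (foldr push u v) w = foldr push u (foldr push v w)"
  by (induction u) (auto simp: foldr_push_push)

lemma foldr_push_inverse:
  "reduced w \<Longrightarrow> foldr push (rev (map linv u)) (foldr push u w) = w"
proof (induction u)
  case (Cons a u)
  then show ?case
    using push_linv[of "foldr push u w" "linv a"] by (simp add: reduced_foldr_push)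
qed simp

lemma set_push: "set (push a w) \<subseteq> insert a (set w)"
  by (cases w) auto

lemma set_foldr_push: "set (foldr push u v) \<subseteq> set u \<union> set v"
  by (induction u) (use set_push in fastforce)+

lemma fst_set_foldr_push:
  assumes "fst ` set u \<subseteq> A" "fst ` set v \<subseteq> A"
  shows "fst ` set (foldr push u v) \<subseteq> A"
  using set_foldr_push[of u v] assms by blast

lemma free_group_simps [simp]:
  "w \<in> carrier (free_group n) \<longleftrightarrow> fst ` set w \<subseteq> {..<n} \<and> reduced w"
  "u \<otimes>\<^bsub>free_group n\<^esub> v = foldr push u v"
  "\<one>\<^bsub>free_group n\<^esub> = []"
  by (simp_all add: free_group_def)

lemma group_free_group: "group (free_group n)"
proof (rule groupI)
  fix u v assume "u \<in> carrier (free_group n)" "v \<in> carrier (free_group n)"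
  then show "u \<otimes>\<^bsub>free_group n\<^esub> v \<in> carrier (free_group n)"
    by (simp add: fst_set_foldr_push reduced_foldr_push)
next
  fix u assume u: "u \<in> carrier (free_group n)"
  define v where "v = foldr push (rev (map linv u)) []"
  have "set v \<subseteq> linv ` set u"
    unfolding v_def using set_foldr_push[of "rev (map linv u)" "[]"] by simp
  then have v: "v \<in> carrier (free_group n)"
    using u by (force simp: v_def reduced_foldr_push)
  have "v \<otimes>\<^bsub>free_group n\<^esub> u = foldr push (rev (map linv u)) (foldr push [] u)"
    using u by (simp only: free_group_simps v_def) (simp add: foldr_push_assoc)
  also have "\<dots> = \<one>\<^bsub>free_group n\<^esub>"
    using u foldr_push_inverse[of "[]" u] by (simp add: foldr_push_Nil)
  finally show "\<exists>v\<in>carrier (free_group n). v \<otimes>\<^bsub>free_group n\<^esub> u = \<one>\<^bsub>free_group n\<^esub>"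
    using v by blast
qed (auto simp: foldr_push_assoc)

lemma free_gen_carrier: "i < n \<Longrightarrow> free_gen i \<in> carrier (free_group n)"
  by (simp add: free_gen_def reduced_Cons)

lemma inv_free_gen:
  assumes "i < n"
  shows "inv\<^bsub>free_group n\<^esub> free_gen i = [(i, False)]"
  by (rule group.inv_equality[OF group_free_group])
     (use assms in \<open>auto simp: free_gen_def reduced_Cons linv_def\<close>)

text \<open>The universal property of \<open>free_group n\<close>.\<close>

lemma generate_free_gen:
  "generate (free_group n) (free_gen ` {..<n}) = carrier (free_group n)"
proof
  interpret group "free_group n" by (rule group_free_group)
  show "generate (free_group n) (free_gen ` {..<n}) \<subseteq> carrier (free_group n)"
    by (rule generate_incl) (use free_gen_carrier in blast)
  show "carrier (free_group n) \<subseteq> generate (free_group n) (free_gen ` {..<n})"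
  proof
    fix w assume "w \<in> carrier (free_group n)"
    then show "w \<in> generate (free_group n) (free_gen ` {..<n})"
    proof (induction w)
      case Nil
      then show ?case using generate.one[of "free_group n"] by simp
    next
      case (Cons a w)
      obtain i e where a: "a = (i, e)" by force
      have i: "i < n" using Cons.prems a by simp
      have w: "w \<in> generate (free_group n) (free_gen ` {..<n})"
        using Cons by (simp add: reduced_Cons)
      have "[a] \<in> generate (free_group n) (free_gen ` {..<n})"
      proof (cases e)
        case True
        then show ?thesis
          using i a generate.incl[of "free_gen i" "free_gen ` {..<n}" "free_group n"]
          by (simp add: free_gen_def)
      next
        case False
        then show ?thesis
          using i a inv_free_gen[OF i]
            generate.inv[of "free_gen i" "free_gen ` {..<n}" "free_group n"]
          by simp
      qed
      from generate.eng[OF this w] show ?case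
        using Cons.prems by (simp add: push_reduced_Cons)
    qed
  qed
qed

lemma free_group_universal:
  fixes G (structure)
  assumes "group G" and f: "\<And>i. i < n \<Longrightarrow> f i \<in> carrier G"
  shows "\<exists>h\<in>hom (free_group n) G. \<forall>i<n. h (free_gen i) = f i"
proof -
  interpret group G by fact
  define g where "g = (\<lambda>(i, e). if e then f i else inv (f i))"
  define h where "h = (\<lambda>w. foldr (\<lambda>a y. g a \<otimes> y) w \<one>)"
  have g: "g a \<in> carrier G" if "fst a < n" for a
    using f that by (auto simp: g_def split: prod.splits)
  have g_linv: "g (linv a) = inv (g a)" if "fst a < n" for a
    using f that by (auto simp: g_def linv_def split: prod.splits)
  have h: "h w \<in> carrier G" if "fst ` set w \<subseteq> {..<n}" for w
    using that by (induction w) (auto simp: h_def g)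
  have h_push: "h (push a w) = g a \<otimes> h w" if "fst a < n" "fst ` set w \<subseteq> {..<n}" for a w
  proof (cases w)
    case (Cons b v)
    have "g a \<otimes> (inv (g a) \<otimes> h v) = h v"
      using g[of a] h[of v] that Cons by (simp flip: m_assoc)
    then show ?thesis
      using Cons g_linv[OF that(1)] by (auto simp: h_def)
  qed (simp add: h_def)
  have h_mult: "h (foldr push u v) = h u \<otimes> h v"
    if "fst ` set u \<subseteq> {..<n}" "fst ` set v \<subseteq> {..<n}" for u v
    using that(1)
  proof (induction u)
    case Nil
    then show ?case using h[OF that(2)] by (simp add: h_def)
  next
    case (Cons a u)
    have "fst ` set (foldr push u v) \<subseteq> {..<n}"
      using Cons.prems that(2) by (intro fst_set_foldr_push) auto
    then have "h (foldr push (a # u) v) = g a \<otimes> (h u \<otimes> h v)"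
      using h_push[of a "foldr push u v"] Cons by simp
    also have "\<dots> = (g a \<otimes> h u) \<otimes> h v"
      using g[of a] h[of u] h[OF that(2)] Cons.prems by (simp add: m_assoc)
    also have "g a \<otimes> h u = h (a # u)"
      by (simp add: h_def)
    finally show ?case .
  qed
  have "h \<in> hom (free_group n) G"
    by (rule homI) (simp_all add: h h_mult)
  moreover have "h (free_gen i) = f i" if "i < n" for i
    using f[OF that] by (simp add: h_def g_def free_gen_def)
  ultimately show ?thesis by blast
qed

lemma shift_free_gen: "shift n (free_gen i) = free_gen ((i + 1) mod n)"
  by (simp add: shift_def free_gen_def)

lemma shift_iso: "shift n \<in> iso (free_group n) (free_group n)"
proof -
  define p where "p = (\<lambda>i. (i + 1) mod n)"
  define P where "P = (\<lambda>(i, e::bool). (p i, e))"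
  have shift: "shift n = map P"
    by (simp add: shift_def P_def p_def)
  have p_lt: "p i < n" if "i < n" for i
    using that by (simp add: p_def)
  have inj: "inj_on p {..<n}"
    by (rule inj_onI) (auto simp: p_def mod_Suc split: if_splits)
  have surj: "p ` {..<n} = {..<n}"
    by (rule endo_inj_surj) (use inj p_lt in auto)
  have fst_P: "fst (P a) = p (fst a)" for a
    by (simp add: P_def split: prod.splits)
  have P_linv: "P b = linv (P a) \<longleftrightarrow> b = linv a" if "fst a < n" "fst b < n" for a b
    using that inj by (auto simp: P_def linv_def inj_on_def split: prod.splits)
  have push: "map P (push a w) = push (P a) (map P w)"
    if "fst a < n" "fst ` set w \<subseteq> {..<n}" for a w
    using that by (cases w) (auto simp: P_linv)
  have closed: "fst ` set (map P w) \<subseteq> {..<n}" if "fst ` set w \<subseteq> {..<n}" for w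
    using that p_lt by (auto simp: fst_P)
  have red: "reduced (map P w) \<longleftrightarrow> reduced w" if "fst ` set w \<subseteq> {..<n}" for w
    using that
  proof (induction w)
    case (Cons a w)
    then show ?case by (cases w) (auto simp: reduced_Cons P_linv)
  qed simp
  have mult: "map P (foldr push u v) = foldr push (map P u) (map P v)"
    if "fst ` set u \<subseteq> {..<n}" "fst ` set v \<subseteq> {..<n}" for u v
    using that
  proof (induction u)
    case (Cons a u)
    have "fst ` set (foldr push u v) \<subseteq> {..<n}"
      using Cons.prems by (intro fst_set_foldr_push) auto
    then show ?case using push[of a "foldr push u v"] Cons by simp
  qed simp
  have "shift n \<in> hom (free_group n) (free_group n)"
    by (rule homI) (use closed red mult in \<open>auto simp: shift\<close>)
  moreover have "inj_on (shift n) (carrier (free_group n))"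
  proof (rule inj_onI)
    fix u v
    assume u: "u \<in> carrier (free_group n)" and v: "v \<in> carrier (free_group n)"
      and eq: "shift n u = shift n v"
    have "inj_on P (set u \<union> set v)"
    proof (rule inj_onI)
      fix a b assume "a \<in> set u \<union> set v" "b \<in> set u \<union> set v" "P a = P b"
      moreover from this u v have "fst a < n" "fst b < n" by auto
      ultimately show "a = b"
        using P_linv[of "linv b" a] by (metis P_linv linv_linv fst_linv)
    qed
    then show "u = v" using eq by (simp add: shift inj_on_map_eq_map)
  qed
  moreover have "w \<in> shift n ` carrier (free_group n)" if w: "w \<in> carrier (free_group n)" for w
  proof -
    define v where "v = map (\<lambda>(i, e). (inv_into {..<n} p i, e)) w"
    have inv: "inv_into {..<n} p i < n" "p (inv_into {..<n} p i) = i" if "i < n" for i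
      using inv_into_into[of i p "{..<n}"] f_inv_into_f[of i p "{..<n}"] surj that by auto
    have v: "fst ` set v \<subseteq> {..<n}"
      using w inv by (force simp: v_def)
    have "map P v = map id w"
      unfolding v_def map_map by (rule map_cong) (use w inv in \<open>force simp: P_def\<close>)+
    then have "map P v = w" by simp
    with v w red[OF v] show ?thesis
      by (intro image_eqI[of _ _ v]) (auto simp: shift)
  qed
  ultimately show ?thesis
    by (force simp: iso_def bij_betw_def hom_def)
qed

lemma (in group) normal_normal_closure:
  assumes "R \<subseteq> carrier G"
  shows "normal_closure G R \<lhd> G" "R \<subseteq> normal_closure G R"
proof -
  have "carrier G \<lhd> G"
    by (simp add: normal_inv_iff subgroup_self)
  then have ne: "{N. N \<lhd> G \<and> R \<subseteq> N} \<noteq> {}"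
    using assms by blast
  have "subgroup (normal_closure G R) G"
    unfolding normal_closure_def
    by (rule subgroups_Inter) (use ne in \<open>auto intro: normal_imp_subgroup\<close>)
  then show "normal_closure G R \<lhd> G"
    by (auto simp: normal_inv_iff normal_closure_def)
  show "R \<subseteq> normal_closure G R"
    by (auto simp: normal_closure_def)
qed

lemma group_presented_group:
  "R \<subseteq> carrier (free_group n) \<Longrightarrow> group (presented_group n R)"
  unfolding presented_group_def
  by (intro normal.factorgroup_is_group group.normal_normal_closure group_free_group)

lemma group_cyclically_presented_group:
  assumes "w \<in> carrier (free_group n)"
  shows "group (cyclically_presented_group n w)"
proof -
  have "(shift n ^^ j) w \<in> carrier (free_group n)" for j
  proof (induction j)
    case (Suc j)
    have "shift n \<in> carrier (free_group n) \<rightarrow> carrier (free_group n)"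
      using shift_iso[of n] by (simp add: iso_def hom_def)
    with Suc show ?case by (auto simp del: free_group_simps)
  qed (use assms in simp)
  then show ?thesis
    unfolding cyclically_presented_group_def by (intro group_presented_group) blast
qed

lemma (in group) list_mult_closed: "set xs \<subseteq> carrier G \<Longrightarrow> list_mult G xs \<in> carrier G"
  by (induction xs) (auto simp: list_mult_def)

lemma group_Prishchepov_group:
  assumes "n \<ge> 1"
  shows "group (Prishchepov_group r n k s q)"
proof -
  interpret F: group "free_group n" by (rule group_free_group)
  have "Prishchepov_word r n k s q \<in> carrier (free_group n)"
    unfolding Prishchepov_word_def
    by (intro F.m_closed F.inv_closed F.list_mult_closed)
       (use assms in \<open>auto intro!: free_gen_carrier simp del: free_group_simps\<close>)
  then show ?thesis
    unfolding Prishchepov_group_def by (rule group_cyclically_presented_group)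
qed

end

theory Submission
  imports Defs
begin

text \<open>
  The abelianisation of a cyclically presented group \<open>G\<^sub>n(w)\<close> is the additive group of
  \<open>\<int>[t]/(t\<^sup>n - 1, f)\<close>, where \<open>f\<close> records the exponent sums of the generators in \<open>w\<close>. So if the
  group is perfect, then \<open>f\<close> is a unit of the integral group ring \<open>\<int>[C\<^sub>n]\<close> (\<open>unit_if_perfect\<close>).

  Units of \<open>\<int>[C\<^sub>n]\<close> are almost symmetric. Write a bar for the involution \<open>t \<mapsto> t\<^sup>-\<^sup>1\<close> and let \<open>u\<close>
  be the inverse of \<open>f\<close>. Then \<open>v = f \<cdot> bar u\<close> satisfies \<open>v \<cdot> bar v = 1\<close>. The coefficient of \<open>1\<close> in
  \<open>v \<cdot> bar v\<close> is the sum of the squares of the coefficients of \<open>v\<close>, which are integers, so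
  \<open>v = \<plusminus>t\<^sup>j\<close> and \<open>f = \<plusminus>t\<^sup>j \<cdot> bar f\<close>. The augmentation \<open>t \<mapsto> 1\<close> sends \<open>f\<close> to a nonzero
  integer, and this forces the positive sign (\<open>unit_reflect\<close>).

  For a Prishchepov group and \<open>l = k - 1\<close>, multiplying \<open>f\<close> by \<open>1 - t\<^sup>q\<close> collapses its two geometric
  sums to \<open>g = 1 - t\<^sup>r\<^sup>q - t\<^sup>l + t\<^sup>l\<^sup>+\<^sup>s\<^sup>q\<close>, and the symmetry of \<open>f\<close> becomes
  \<open>g = -t\<^sup>c \<cdot> bar g\<close> for some \<open>c\<close>. If a positive term of \<open>g\<close> cancels a negative one modulo
  \<open>t\<^sup>n - 1\<close>, the corresponding congruence is one of those in the definition of trivially perfect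
  parameters. Otherwise the reflection \<open>m \<mapsto> c - m\<close> has to carry the exponents \<open>{0, l + sq}\<close> of
  the positive terms onto the exponents \<open>{rq, l}\<close> of the negative ones, and its two ways of doing so
  are the two congruences of type \<open>Z\<close>-tilde (\<open>antisymmetric_four_term\<close>). Finally, the augmentation
  of \<open>f\<close> is \<open>r - s\<close>; it is a unit of \<open>\<int>\<close>, hence equal to \<open>1\<close> as \<open>r \<ge> s\<close>.
\<close>

section \<open>Perfect quotients\<close>

lemma (in group) derived_eq_carrier_if_perfect:
  assumes "perfect_group G"
  shows "derived G (carrier G) = carrier G"
proof
  interpret D: normal "derived G (carrier G)" G
    by (rule derived_self_is_normal)
  show "derived G (carrier G) \<subseteq> carrier G"
    by (rule D.subset)
  show "carrier G \<subseteq> derived G (carrier G)"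
  proof
    fix x assume x: "x \<in> carrier G"
    have "derived G (carrier G) #> x = derived G (carrier G)"
      using assms x
      by (auto simp: perfect_group_def abelianisation_def trivial_group_def FactGroup_def RCOSETS_def)
    then show "x \<in> derived G (carrier G)"
      using rcos_self[OF x D.is_subgroup] by simp
  qed
qed

text \<open>
  The image of \<open>K\<close> in the quotient is a subgroup that contains all commutators, hence the derived
  subgroup, which is the whole quotient. As \<open>K\<close> contains the kernel \<open>N\<close>, it is all of \<open>G\<close>.
\<close>

lemma (in group) carrier_subset_if_perfect_quotient:
  assumes N: "N \<lhd> G" and perf: "perfect_group (G Mod N)"
    and K: "subgroup K G" "N \<subseteq> K"
    and comm: "\<And>x y. x \<in> carrier G \<Longrightarrow> y \<in> carrier G \<Longrightarrow> x \<otimes> y \<otimes> inv x \<otimes> inv y \<in> K"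
  shows "carrier G \<subseteq> K"
proof -
  interpret N: normal N G by fact
  interpret Q: group "G Mod N" by (rule N.factorgroup_is_group)
  define \<pi> where "\<pi> = (\<lambda>x. N #> x)"
  interpret \<pi>: group_hom G "G Mod N" \<pi>
    using N.r_coset_hom_Mod unfolding \<pi>_def
    by (intro group_hom.intro group_hom_axioms.intro is_group Q.is_group)
  have surj: "carrier (G Mod N) = \<pi> ` carrier G"
    by (auto simp: \<pi>_def FactGroup_def RCOSETS_def)
  have sub: "subgroup (\<pi> ` K) (G Mod N)"
    by (rule \<pi>.subgroup_img_is_subgroup[OF K(1)])
  have "derived_set (G Mod N) (carrier (G Mod N)) \<subseteq> \<pi> ` K"
  proof
    fix z assume "z \<in> derived_set (G Mod N) (carrier (G Mod N))"
    then obtain x y where xy: "x \<in> carrier G" "y \<in> carrier G"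
      and z: "z = \<pi> x \<otimes>\<^bsub>G Mod N\<^esub> \<pi> y \<otimes>\<^bsub>G Mod N\<^esub> inv\<^bsub>G Mod N\<^esub> \<pi> x \<otimes>\<^bsub>G Mod N\<^esub> inv\<^bsub>G Mod N\<^esub> \<pi> y"
      unfolding surj by blast
    have "z = \<pi> (x \<otimes> y \<otimes> inv x \<otimes> inv y)"
      using xy by (simp add: z)
    then show "z \<in> \<pi> ` K"
      using comm xy by blast
  qed
  then have "derived (G Mod N) (carrier (G Mod N)) \<subseteq> \<pi> ` K"
    unfolding derived_def by (rule Q.generate_subgroup_incl[OF _ sub])
  then have img: "\<pi> ` carrier G \<subseteq> \<pi> ` K"
    using Q.derived_eq_carrier_if_perfect[OF perf] surj by simp
  show ?thesis
  proof
    fix x assume x: "x \<in> carrier G"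
    then obtain y where y: "y \<in> K" "N #> x = N #> y"
      using img unfolding \<pi>_def by blast
    then obtain h where "h \<in> N" "x = h \<otimes> y"
      using rcos_self[OF x N.is_subgroup] by (auto simp: r_coset_def)
    then show "x \<in> K"
      using y K subgroup.m_closed by fast
  qed
qed


section \<open>The integral group ring of a cyclic group\<close>

text \<open>
  Elements of \<open>\<int>[C\<^sub>N]\<close> are represented by their coefficient functions, taken as functions on \<open>\<int>\<close> of
  period \<open>N\<close>: this allows \<open>N\<close> to be a term, and translations and reflections of exponents need no
  explicit reduction modulo \<open>N\<close>. The product is the cyclic convolution \<open>cconv\<close>, multiplication
  by \<open>t\<^sup>j\<close> is \<open>a \<mapsto> (\<lambda>m. a (m - j))\<close>, and the involution \<open>t \<mapsto> t\<^sup>-\<^sup>1\<close> is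
  \<open>a \<mapsto> (\<lambda>m. a (- m))\<close>.
\<close>

definition periodic :: "int \<Rightarrow> (int \<Rightarrow> 'a) \<Rightarrow> bool" where
  "periodic N a \<longleftrightarrow> (\<forall>m. a (m mod N) = a m)"

definition cconv :: "int \<Rightarrow> (int \<Rightarrow> int) \<Rightarrow> (int \<Rightarrow> int) \<Rightarrow> int \<Rightarrow> int" where
  "cconv N a b m = (\<Sum>i\<in>{0..<N}. a i * b (m - i))"

definition delta :: "int \<Rightarrow> int \<Rightarrow> int" where
  "delta N m = of_bool (N dvd m)"

lemma periodicD: "periodic N a \<Longrightarrow> x mod N = y mod N \<Longrightarrow> a x = a y"
  by (metis periodic_def)

lemma periodicI: "(\<And>x y. x mod N = y mod N \<Longrightarrow> a x = a y) \<Longrightarrow> periodic N a"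
  unfolding periodic_def by (metis mod_mod_trivial)

lemma periodic_reflect: "periodic N a \<Longrightarrow> periodic N (\<lambda>m. a (c - m))"
  by (rule periodicI, erule periodicD) (rule mod_diff_cong, simp_all)

lemma periodic_shift: "periodic N a \<Longrightarrow> periodic N (\<lambda>m. a (m + c))"
  by (rule periodicI, erule periodicD) (rule mod_add_cong, simp_all)

lemma periodic_delta: "periodic N (delta N)"
  by (simp add: periodic_def delta_def dvd_mod_iff)

lemma periodic_cconv: "periodic N b \<Longrightarrow> periodic N (cconv N a b)"
  unfolding cconv_def
  by (rule periodicI, intro sum.cong refl arg_cong2[of _ _ _ _ "(*)"], erule periodicD)
     (rule mod_diff_cong, simp_all)

context
  fixes N :: int
  assumes N: "N > 0"
begin

lemma sum_periodic_reflect: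
  assumes "periodic N a"
  shows "(\<Sum>i\<in>{0..<N}. a (c - i)) = (\<Sum>i\<in>{0..<N}. a i)"
proof -
  have "bij_betw (\<lambda>i. (c - i) mod N) {0..<N} {0..<N}"
    by (rule bij_betw_byWitness[where f' = "\<lambda>i. (c - i) mod N"])
       (use N in \<open>auto simp: mod_diff_right_eq\<close>)
  from sum.reindex_bij_betw[OF this, of a] show ?thesis
    using assms by (simp add: periodic_def)
qed

lemma sum_periodic_shift:
  assumes "periodic N a"
  shows "(\<Sum>i\<in>{0..<N}. a (i + c)) = (\<Sum>i\<in>{0..<N}. a i)"
  using sum_periodic_reflect[OF periodic_reflect[OF assms, of 0], of "- c"]
    sum_periodic_reflect[OF assms, of 0]
  by (simp add: add.commute)

lemma cconv_commute:
  assumes "periodic N a" "periodic N b"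
  shows "cconv N a b = cconv N b a"
proof
  fix m
  have "periodic N (\<lambda>i. a i * b (m - i))"
    using assms(1) periodic_reflect[OF assms(2), of m] by (simp add: periodic_def)
  from sum_periodic_reflect[OF this, of m] show "cconv N a b m = cconv N b a m"
    by (simp add: cconv_def mult.commute)
qed

lemma cconv_assoc:
  assumes "periodic N b" "periodic N c"
  shows "cconv N (cconv N a b) c = cconv N a (cconv N b c)"
proof
  fix m
  have shift: "(\<Sum>j\<in>{0..<N}. b (j - i) * c (m - j)) = cconv N b c (m - i)" for i
  proof -
    have "periodic N (\<lambda>j. b j * c (m - i - j))"
      using assms(1) periodic_reflect[OF assms(2), of "m - i"] by (simp add: periodic_def)
    from sum_periodic_shift[OF this, of "- i"] show ?thesis
      by (simp add: cconv_def)
  qed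
  have "cconv N (cconv N a b) c m = (\<Sum>j\<in>{0..<N}. \<Sum>i\<in>{0..<N}. a i * (b (j - i) * c (m - j)))"
    by (simp add: cconv_def sum_distrib_right mult.assoc)
  also have "\<dots> = (\<Sum>i\<in>{0..<N}. \<Sum>j\<in>{0..<N}. a i * (b (j - i) * c (m - j)))"
    by (rule sum.swap)
  also have "\<dots> = (\<Sum>i\<in>{0..<N}. a i * cconv N b c (m - i))"
    by (simp add: shift flip: sum_distrib_left)
  finally show "cconv N (cconv N a b) c m = cconv N a (cconv N b c) m"
    by (simp add: cconv_def)
qed

lemma cconv_delta_left:
  assumes "periodic N a"
  shows "cconv N (\<lambda>m. delta N (m - j)) a m = a (m - j)"
proof -
  have "delta N (i - j) * a (m - i) = (if i = j mod N then a (m - j) else 0)"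
    if "i \<in> {0..<N}" for i
  proof -
    have "N dvd i - j \<longleftrightarrow> i = j mod N"
      using that by (simp flip: mod_eq_dvd_iff)
    then show ?thesis
      using assms by (auto simp: delta_def intro: periodicD mod_diff_right_eq)
  qed
  then have "cconv N (\<lambda>m. delta N (m - j)) a m
      = (\<Sum>i\<in>{0..<N}. if i = j mod N then a (m - j) else 0)"
    unfolding cconv_def by (intro sum.cong refl)
  then show ?thesis
    using N by simp
qed

lemma cconv_delta_right:
  assumes "periodic N a"
  shows "cconv N a (\<lambda>m. delta N (m - j)) m = a (m - j)"
  using cconv_delta_left[OF assms] cconv_commute[OF assms] periodic_shift[OF periodic_delta, of N "- j"]
  by simp

lemma cconv_reflect:
  assumes "periodic N a" "periodic N b"
  shows "cconv N (\<lambda>m. a (- m)) (\<lambda>m. b (- m)) m = cconv N a b (- m)"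
proof -
  have "periodic N (\<lambda>i. a i * b (- m - i))"
    using assms(1) periodic_reflect[OF assms(2), of "- m"] by (simp add: periodic_def)
  from sum_periodic_reflect[OF this, of 0] show ?thesis
    by (simp add: cconv_def algebra_simps)
qed

text \<open>The augmentation, which is the sum of the coefficients over one period, is multiplicative.\<close>

lemma sum_cconv:
  assumes "periodic N b"
  shows "(\<Sum>m\<in>{0..<N}. cconv N a b m) = (\<Sum>i\<in>{0..<N}. a i) * (\<Sum>i\<in>{0..<N}. b i)"
proof -
  have "(\<Sum>m\<in>{0..<N}. cconv N a b m) = (\<Sum>i\<in>{0..<N}. \<Sum>m\<in>{0..<N}. a i * b (m - i))"
    unfolding cconv_def by (rule sum.swap)
  also have "\<dots> = (\<Sum>i\<in>{0..<N}. a i * (\<Sum>m\<in>{0..<N}. b m))"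
    using sum_periodic_shift[OF assms, of "- i" for i] by (simp flip: sum_distrib_left)
  finally show ?thesis
    by (simp add: sum_distrib_right)
qed

lemma sum_delta_shift: "(\<Sum>m\<in>{0..<N}. delta N (m - j)) = 1"
  using cconv_delta_left[of "\<lambda>_. 1" j 0] by (simp add: cconv_def periodic_def)

text \<open>
  Integrality enters here: a sum of integer squares can only be \<open>1\<close> if exactly one summand is nonzero.
\<close>

lemma delta_if_sum_squares_eq_1:
  assumes per: "periodic N v" and sq: "(\<Sum>i\<in>{0..<N}. v i * v i) = 1"
  obtains j \<epsilon> where "\<epsilon> = 1 \<or> \<epsilon> = - 1" "v = (\<lambda>m. \<epsilon> * delta N (m - j))"
proof -
  obtain j where j: "j \<in> {0..<N}" "v j \<noteq> 0"
    using sq by (metis (no_types, lifting) mult_zero_left sum.neutral zero_neq_one)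
  have split: "v j * v j + (\<Sum>i\<in>{0..<N} - {j}. v i * v i) = 1"
    using sq sum.remove[of "{0..<N}" j "\<lambda>i. v i * v i"] j(1) by simp
  have ge: "v j * v j \<ge> 1"
    using j(2) by (auto simp: int_one_le_iff_zero_less zero_less_mult_iff)
  have nonneg: "(\<Sum>i\<in>{0..<N} - {j}. v i * v i) \<ge> 0"
    by (intro sum_nonneg) simp
  have eq1: "v j * v j = 1" and "(\<Sum>i\<in>{0..<N} - {j}. v i * v i) = 0"
    using split ge nonneg by linarith+
  then have zero: "v i = 0" if "i \<in> {0..<N}" "i \<noteq> j" for i
    using that by (subst (asm) sum_nonneg_eq_0_iff) auto
  have "v j = 1 \<or> v j = - 1"
    using eq1 by (simp add: zmult_eq_1_iff)
  moreover have "v m = v j * delta N (m - j)" for m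
  proof -
    have "N dvd m - j \<longleftrightarrow> m mod N = j"
      using j(1) by (simp flip: mod_eq_dvd_iff)
    moreover have "v m = v (m mod N)"
      using per by (simp add: periodic_def)
    moreover have "m mod N \<in> {0..<N}"
      using N by simp
    ultimately show ?thesis
      using zero by (auto simp: delta_def)
  qed
  ultimately show thesis
    using that by blast
qed

lemma augmentation_unit:
  assumes "periodic N u" and "cconv N f u = delta N"
  shows "(\<Sum>m\<in>{0..<N}. f m) * (\<Sum>m\<in>{0..<N}. u m) = 1"
  using sum_cconv[OF assms(1), of f] sum_delta_shift[of 0] by (simp add: assms(2))

text \<open>
  A unit of \<open>\<int>[C\<^sub>N]\<close> and its image under the involution \<open>t \<mapsto> t\<^sup>-\<^sup>1\<close> differ by a unit \<open>v\<close> that is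
  inverse to its own image. Comparing coefficients of \<open>1\<close> shows that \<open>v\<close> is \<open>\<plusminus>t\<^sup>j\<close>.
\<close>

lemma unit_reflect:
  assumes f: "periodic N f" and u: "periodic N u" and fu: "cconv N f u = delta N"
  obtains j where "\<And>m. f m = f (j - m)"
proof -
  define f' where "f' = (\<lambda>m. f (- m))"
  define u' where "u' = (\<lambda>m. u (- m))"
  have f': "periodic N f'" and u': "periodic N u'"
    unfolding f'_def u'_def
    using periodic_reflect[OF f, of 0] periodic_reflect[OF u, of 0] by simp_all
  have fu': "cconv N f' u' = delta N"
    using cconv_reflect[OF f u] by (simp add: f'_def u'_def fu fun_eq_iff delta_def)
  define v where "v = cconv N f u'"
  have v: "periodic N v"
    unfolding v_def by (rule periodic_cconv[OF u'])
  have vf': "cconv N v f' = f"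
  proof -
    have "cconv N v f' = cconv N f (cconv N u' f')"
      unfolding v_def by (rule cconv_assoc[OF u' f'])
    also have "\<dots> = cconv N f (delta N)"
      using cconv_commute[OF f' u'] fu' by simp
    also have "\<dots> = f"
      using cconv_delta_right[OF f, of 0] by (simp add: fun_eq_iff)
    finally show ?thesis .
  qed
  have v_reflect: "v (- m) = cconv N f' u m" for m
    using cconv_reflect[OF f u', of m] by (simp add: v_def f'_def u'_def)
  \<comment> \<open>The coefficient of \<open>1\<close> in \<open>v \<cdot> bar v = 1\<close> is the sum of the squares of the coefficients of \<open>v\<close>.\<close>
  have "cconv N v (\<lambda>m. v (- m)) = cconv N v (cconv N f' u)"
    by (simp add: v_reflect)
  also have "\<dots> = delta N"
    using cconv_assoc[OF f' u, of v] vf' fu by simp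
  finally have "cconv N v (\<lambda>m. v (- m)) 0 = delta N 0"
    by simp
  then have "(\<Sum>i\<in>{0..<N}. v i * v i) = 1"
    by (simp add: cconv_def delta_def)
  then obtain j \<epsilon> where eps: "\<epsilon> = 1 \<or> \<epsilon> = - 1" and vj: "v = (\<lambda>m. \<epsilon> * delta N (m - j))"
    by (rule delta_if_sum_squares_eq_1[OF v])
  have refl: "f m = \<epsilon> * f (j - m)" for m
  proof -
    have "f m = cconv N v f' m"
      by (simp add: vf')
    also have "\<dots> = \<epsilon> * cconv N (\<lambda>m. delta N (m - j)) f' m"
      by (simp add: vj cconv_def sum_distrib_left mult.assoc)
    also have "\<dots> = \<epsilon> * f (j - m)"
      using cconv_delta_left[OF f', of j m] by (simp add: f'_def)
    finally show ?thesis .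
  qed
  \<comment> \<open>The sign is determined by the augmentation of \<open>f\<close>, which the reflection preserves.\<close>
  have "(\<Sum>m\<in>{0..<N}. f m) \<noteq> 0"
    using augmentation_unit[OF u fu] by auto
  moreover have "(\<Sum>m\<in>{0..<N}. f m) = \<epsilon> * (\<Sum>m\<in>{0..<N}. f m)"
  proof -
    have "(\<Sum>m\<in>{0..<N}. f m) = (\<Sum>m\<in>{0..<N}. \<epsilon> * f (j - m))"
      using refl by (rule sum.cong[OF HOL.refl])
    then show ?thesis
      using sum_periodic_reflect[OF f, of j] by (simp flip: sum_distrib_left)
  qed
  ultimately have "\<epsilon> = 1"
    by auto
  then have "f m = f (j - m)" for m
    using refl[of m] by simp
  then show thesis
    by (rule that)
qed

end


section \<open>Perfect cyclically presented groups\<close>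

text \<open>
  The homomorphism \<open>F\<^sub>n \<rightarrow> \<int>[C\<^sub>n]\<close> that sends \<open>x\<^sub>i\<close> to \<open>t\<^sup>i\<close>; it turns the shift into
  multiplication by \<open>t\<close>.
\<close>

fun letter_vec :: "nat \<Rightarrow> letter \<Rightarrow> int \<Rightarrow> int" where
  "letter_vec n (i, e) m = (if e then 1 else - 1) * delta (int n) (m - int i)"

definition exponent_vec :: "nat \<Rightarrow> letter list \<Rightarrow> int \<Rightarrow> int" where
  "exponent_vec n w m = (\<Sum>a\<leftarrow>w. letter_vec n a m)"

lemma exponent_vec_Nil [simp]: "exponent_vec n [] m = 0"
  by (simp add: exponent_vec_def)

lemma exponent_vec_Cons [simp]:
  "exponent_vec n (a # w) m = letter_vec n a m + exponent_vec n w m"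
  by (simp add: exponent_vec_def)

lemma periodic_letter_vec: "periodic (int n) (letter_vec n a)"
  using periodic_shift[OF periodic_delta, of "int n" "- int (fst a)"]
  by (cases a) (simp add: periodic_def)

lemma periodic_exponent_vec: "periodic (int n) (exponent_vec n w)"
  by (induction w) (use periodic_letter_vec in \<open>auto simp: periodic_def\<close>)

text \<open>Cancelling letters contribute opposite amounts, so free reduction preserves exponent vectors.\<close>

lemma exponent_vec_push: "exponent_vec n (push a w) m = letter_vec n a m + exponent_vec n w m"
  by (cases a; cases w) (auto simp: linv_def)

lemma exponent_vec_mult:
  "exponent_vec n (u \<otimes>\<^bsub>free_group n\<^esub> v) m = exponent_vec n u m + exponent_vec n v m"
proof -
  have "exponent_vec n (foldr push u v) m = exponent_vec n u m + exponent_vec n v m"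
    by (induction u) (auto simp: exponent_vec_push)
  then show ?thesis by simp
qed

lemma exponent_vec_inv:
  assumes "w \<in> carrier (free_group n)"
  shows "exponent_vec n (inv\<^bsub>free_group n\<^esub> w) m = - exponent_vec n w m"
proof -
  interpret group "free_group n" by (rule group_free_group)
  have "exponent_vec n (inv\<^bsub>free_group n\<^esub> w \<otimes>\<^bsub>free_group n\<^esub> w) m = 0"
    using l_inv[OF assms] by (simp del: free_group_simps(2))
  then show ?thesis
    by (simp only: exponent_vec_mult)
qed

lemma exponent_vec_list_mult:
  "exponent_vec n (list_mult (free_group n) ws) m = (\<Sum>w\<leftarrow>ws. exponent_vec n w m)"
  by (induction ws) (simp_all add: list_mult_def exponent_vec_mult del: free_group_simps(2))

lemma exponent_vec_free_gen: "exponent_vec n (free_gen i) m = delta (int n) (m - int i)"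
  by (simp add: free_gen_def)

lemma exponent_vec_shift: "exponent_vec n (shift n w) m = exponent_vec n w (m - 1)"
proof (induction w)
  case (Cons a w)
  obtain i e where a: "a = (i, e)" by force
  have "(m - (int i + 1) mod int n) mod int n = (m - 1 - int i) mod int n"
    by (metis diff_diff_eq2 diff_diff_add add.commute mod_diff_right_eq)
  then have "delta (int n) (m - int ((i + 1) mod n)) = delta (int n) (m - 1 - int i)"
    by (intro periodicD[OF periodic_delta]) (simp add: zmod_int add.commute)
  then show ?case
    using Cons by (simp add: shift_def a)
qed (simp add: shift_def)

lemma exponent_vec_shift_funpow:
  "exponent_vec n ((shift n ^^ j) w) m = exponent_vec n w (m - int j)"
  by (induction j arbitrary: m) (simp_all add: exponent_vec_shift algebra_simps)

text \<open>
  The words whose exponent vector lies in the ideal generated by \<open>exponent_vec n w\<close> form a normal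
  subgroup that contains the relators and all commutators. If the presented group is perfect, this
  subgroup is the whole free group. In particular it contains \<open>x\<^sub>0\<close>, whose exponent vector is \<open>1\<close>.
\<close>

lemma unit_if_perfect:
  assumes n: "n \<ge> 1" and w: "w \<in> carrier (free_group n)"
    and perf: "perfect_group (cyclically_presented_group n w)"
  obtains u where "periodic (int n) u" "cconv (int n) (exponent_vec n w) u = delta (int n)"
proof -
  let ?F = "free_group n" and ?f = "exponent_vec n w"
  interpret F: group ?F by (rule group_free_group)
  define R where "R = {(shift n ^^ j) w | j. j < n}"
  define K where "K = {x \<in> carrier ?F. \<exists>u. periodic (int n) u \<and> cconv (int n) ?f u = exponent_vec n x}"
  have K_zero: "x \<in> K" if "x \<in> carrier ?F" "\<And>m. exponent_vec n x m = 0" for x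
    unfolding K_def using that
    by (auto simp: periodic_def cconv_def fun_eq_iff simp del: free_group_simps intro!: exI[of _ "\<lambda>_. 0"])
  have K_mult: "x \<otimes>\<^bsub>?F\<^esub> y \<in> K" if x: "x \<in> K" and y: "y \<in> K" for x y
  proof -
    obtain u where u: "periodic (int n) u" "cconv (int n) ?f u = exponent_vec n x"
      using x unfolding K_def by blast
    obtain v where v: "periodic (int n) v" "cconv (int n) ?f v = exponent_vec n y"
      using y unfolding K_def by blast
    from u v have "periodic (int n) (\<lambda>m. u m + v m)"
      and "cconv (int n) ?f (\<lambda>m. u m + v m) = exponent_vec n (x \<otimes>\<^bsub>?F\<^esub> y)"
      unfolding periodic_def fun_eq_iff exponent_vec_mult
      by (simp_all add: cconv_def distrib_left sum.distrib)
    moreover have "x \<otimes>\<^bsub>?F\<^esub> y \<in> carrier ?F"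
      using x y unfolding K_def by (intro F.m_closed) blast+
    ultimately show ?thesis unfolding K_def by blast
  qed
  have K_inv: "inv\<^bsub>?F\<^esub> x \<in> K" if xK: "x \<in> K" for x
  proof -
    obtain u where "periodic (int n) u" "cconv (int n) ?f u = exponent_vec n x"
      and x: "x \<in> carrier ?F"
      using xK unfolding K_def by blast
    then have "periodic (int n) (\<lambda>m. - u m)"
      and "cconv (int n) ?f (\<lambda>m. - u m) = exponent_vec n (inv\<^bsub>?F\<^esub> x)"
      unfolding periodic_def fun_eq_iff exponent_vec_inv[OF x]
      by (simp_all add: cconv_def sum_negf)
    then show ?thesis using F.inv_closed[OF x] unfolding K_def by blast
  qed
  have "\<one>\<^bsub>?F\<^esub> \<in> K"
    by (rule K_zero[OF F.one_closed]) simp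
  then have K: "subgroup K ?F"
    by (intro F.subgroupI K_mult K_inv) (auto simp only: K_def)
  have "K \<lhd> ?F"
  proof (rule F.normal_invI[OF K])
    fix x h assume x: "x \<in> carrier ?F" and h: "h \<in> K"
    then have "h \<in> carrier ?F" by (simp add: K_def)
    then have "x \<otimes>\<^bsub>?F\<^esub> h \<otimes>\<^bsub>?F\<^esub> inv\<^bsub>?F\<^esub> x \<in> carrier ?F"
      using x by (intro F.m_closed F.inv_closed)
    moreover have "exponent_vec n (x \<otimes>\<^bsub>?F\<^esub> h \<otimes>\<^bsub>?F\<^esub> inv\<^bsub>?F\<^esub> x) = exponent_vec n h"
      unfolding fun_eq_iff exponent_vec_mult exponent_vec_inv[OF x] by simp
    ultimately show "x \<otimes>\<^bsub>?F\<^esub> h \<otimes>\<^bsub>?F\<^esub> inv\<^bsub>?F\<^esub> x \<in> K"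
      using h by (simp add: K_def del: free_group_simps)
  qed
  have shift_closed: "(shift n ^^ j) w \<in> carrier ?F" for j
  proof (induction j)
    case (Suc j)
    have "shift n \<in> carrier ?F \<rightarrow> carrier ?F"
      using shift_iso[of n] by (simp add: iso_def hom_def)
    with Suc show ?case by (auto simp del: free_group_simps)
  qed (use w in simp)
  have R: "R \<subseteq> carrier ?F"
    using shift_closed unfolding R_def by blast
  \<comment> \<open>The exponent vector of the \<open>j\<close>-th relator is the product of that of \<open>w\<close> and \<open>t\<^sup>j\<close>.\<close>
  have "(shift n ^^ j) w \<in> K" for j
  proof -
    have "cconv (int n) ?f (\<lambda>m. delta (int n) (m - int j)) = exponent_vec n ((shift n ^^ j) w)"
      using n by (simp add: fun_eq_iff exponent_vec_shift_funpow cconv_delta_right periodic_exponent_vec)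
    then show ?thesis
      using shift_closed periodic_shift[OF periodic_delta, of "int n" "- int j"]
      unfolding K_def by auto
  qed
  then have "R \<subseteq> K"
    unfolding R_def by blast
  have comm: "x \<otimes>\<^bsub>?F\<^esub> y \<otimes>\<^bsub>?F\<^esub> inv\<^bsub>?F\<^esub> x \<otimes>\<^bsub>?F\<^esub> inv\<^bsub>?F\<^esub> y \<in> K"
    if "x \<in> carrier ?F" "y \<in> carrier ?F" for x y
  proof (rule K_zero)
    show "x \<otimes>\<^bsub>?F\<^esub> y \<otimes>\<^bsub>?F\<^esub> inv\<^bsub>?F\<^esub> x \<otimes>\<^bsub>?F\<^esub> inv\<^bsub>?F\<^esub> y \<in> carrier ?F"
      using that by (intro F.m_closed F.inv_closed)
    show "exponent_vec n (x \<otimes>\<^bsub>?F\<^esub> y \<otimes>\<^bsub>?F\<^esub> inv\<^bsub>?F\<^esub> x \<otimes>\<^bsub>?F\<^esub> inv\<^bsub>?F\<^esub> y) m = 0" for m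
      unfolding exponent_vec_mult exponent_vec_inv[OF that(1)] exponent_vec_inv[OF that(2)] by simp
  qed
  have "carrier ?F \<subseteq> K"
  proof (rule F.carrier_subset_if_perfect_quotient[OF _ _ K _ comm])
    show "normal_closure ?F R \<lhd> ?F"
      by (rule F.normal_normal_closure(1)[OF R])
    show "perfect_group (?F Mod normal_closure ?F R)"
      using perf by (simp add: cyclically_presented_group_def presented_group_def R_def)
    show "normal_closure ?F R \<subseteq> K"
      using \<open>K \<lhd> ?F\<close> \<open>R \<subseteq> K\<close> by (auto simp: normal_closure_def)
  qed
  moreover have "free_gen 0 \<in> carrier ?F"
    using n by (intro free_gen_carrier) simp
  ultimately obtain u where "periodic (int n) u" "cconv (int n) ?f u = exponent_vec n (free_gen 0)"
    unfolding K_def by blast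
  moreover have "exponent_vec n (free_gen 0) = delta (int n)"
    by (simp add: fun_eq_iff exponent_vec_free_gen)
  ultimately show thesis
    using that by simp
qed


section \<open>Prishchepov groups\<close>

lemma Prishchepov_word_carrier:
  assumes "n \<ge> 1"
  shows "Prishchepov_word r n k s q \<in> carrier (free_group n)"
proof -
  interpret F: group "free_group n" by (rule group_free_group)
  show ?thesis
    unfolding Prishchepov_word_def
    by (intro F.m_closed F.inv_closed F.list_mult_closed)
       (use assms in \<open>auto intro!: free_gen_carrier simp del: free_group_simps\<close>)
qed

lemma delta_mod_nat: "delta (int n) (m - int (a mod n)) = delta (int n) (m - int a)"
  by (rule periodicD[OF periodic_delta]) (simp add: zmod_int mod_diff_right_eq)

lemma exponent_vec_Prishchepov_word:
  assumes "n \<ge> 1"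
  shows "exponent_vec n (Prishchepov_word r n k s q) m =
    (\<Sum>i<r. delta (int n) (m - int (i * q))) - (\<Sum>i<s. delta (int n) (m - int (k - 1 + i * q)))"
proof -
  interpret F: group "free_group n" by (rule group_free_group)
  have "list_mult (free_group n) (map (\<lambda>i. free_gen ((k - 1 + i * q) mod n)) [0..<s])
      \<in> carrier (free_group n)"
    by (intro F.list_mult_closed)
       (use assms in \<open>auto intro!: free_gen_carrier simp del: free_group_simps\<close>)
  then show ?thesis
    unfolding Prishchepov_word_def
    by (simp add: exponent_vec_mult exponent_vec_inv exponent_vec_list_mult exponent_vec_free_gen
        delta_mod_nat o_def interv_sum_list_conv_sum_set_nat lessThan_atLeast0
        del: free_group_simps of_nat_add of_nat_mult)
qed

text \<open>
  The hypothesis \<open>anti\<close> says \<open>g = -t\<^sup>c \<cdot> bar g\<close> for \<open>g = 1 - t\<^sup>r\<^sup>q - t\<^sup>l + t\<^sup>l\<^sup>+\<^sup>s\<^sup>q\<close>, and \<open>nd\<close> says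
  that no positive term of \<open>g\<close> cancels a negative one. Hence both exponents \<open>0\<close> and \<open>l + sq\<close> of
  the positive terms are reflections of exponents \<open>rq\<close> or \<open>l\<close> of the negative terms. If they are
  reflections of different exponents, eliminating \<open>c\<close> gives the conclusion. If they are reflections
  of the same exponent, then the positive terms coincide, \<open>g\<close> has coefficient \<open>2\<close> at \<open>0\<close>, and so
  the negative terms coincide as well: now \<open>rq\<close>, \<open>l\<close> and \<open>-sq\<close> are congruent modulo \<open>N\<close>.
\<close>

lemma antisymmetric_four_term:
  fixes N r s q l c :: int
  assumes anti: "\<And>m. delta N m - delta N (m - r * q) - delta N (m - l) + delta N (m - l - s * q)
      = - (delta N (c - m) - delta N (c - m - r * q) - delta N (c - m - l) + delta N (c - m - l - s * q))"
    and nd: "\<not> N dvd r * q" "\<not> N dvd l" "\<not> N dvd l + s * q - r * q" "\<not> N dvd s * q"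
  shows "N dvd (r - s) * q - 2 * l \<or> N dvd (r + s) * q"
proof -
  have nonneg: "delta N x \<ge> 0" for x
    by (simp add: delta_def)
  \<comment> \<open>Compare the coefficients at \<open>0\<close>, where the term \<open>t\<^sup>l\<^sup>+\<^sup>s\<^sup>q\<close> may contribute a second time.\<close>
  have "delta N 0 = 1" "delta N (0 - r * q) = 0" "delta N (0 - l) = 0"
    using nd by (simp_all add: delta_def)
  then have at0: "1 + delta N (- l - s * q) \<le> delta N (c - r * q) + delta N (c - l)"
    using anti[of 0] nonneg[of c] nonneg[of "c - l - s * q"] by simp
  \<comment> \<open>Compare the coefficients at \<open>l + s * q\<close>.\<close>
  have "delta N (l + s * q - r * q) = 0" "delta N (l + s * q - l) = 0"
    "delta N (l + s * q - l - s * q) = 1"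
    using nd by (simp_all add: delta_def)
  then have at1: "1 \<le> delta N (c - (l + s * q) - r * q) + delta N (c - (l + s * q) - l)"
    using anti[of "l + s * q"] nonneg[of "l + s * q"] nonneg[of "c - (l + s * q)"]
      nonneg[of "c - (l + s * q) - l - s * q"]
    by linarith
  have dvd_if_pos: "N dvd x \<or> N dvd y" if "1 \<le> delta N x + delta N y" for x y
    using that by (cases "N dvd x"; cases "N dvd y") (auto simp: delta_def)
  have "N dvd c - r * q \<or> N dvd c - l"
    using at0 nonneg[of "- l - s * q"] by (intro dvd_if_pos) linarith
  moreover have "N dvd c - (l + s * q) - r * q \<or> N dvd c - (l + s * q) - l"
    using at1 by (rule dvd_if_pos)
  moreover have "N dvd c - r * q \<and> N dvd c - l" if "N dvd - l - s * q"
  proof -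
    have "delta N (- l - s * q) = 1"
      using that by (simp add: delta_def)
    with at0 have "2 \<le> delta N (c - r * q) + delta N (c - l)"
      by simp
    then show ?thesis
      by (cases "N dvd c - r * q"; cases "N dvd c - l") (auto simp: delta_def)
  qed
  moreover have "N dvd - l - s * q" if "N dvd c - r * q" "N dvd c - (l + s * q) - r * q"
    using dvd_diff[OF that(2,1)] by (simp add: algebra_simps)
  moreover have "N dvd - l - s * q" if "N dvd c - l" "N dvd c - (l + s * q) - l"
    using dvd_diff[OF that(2,1)] by (simp add: algebra_simps)
  ultimately consider
      "N dvd c - r * q" "N dvd c - (l + s * q) - l"
    | "N dvd c - l" "N dvd c - (l + s * q) - r * q"
    | "N dvd - l - s * q" "N dvd c - r * q" "N dvd c - l"
    by blast
  then show ?thesis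
  proof cases
    case 1
    have "(r - s) * q - 2 * l = (c - (l + s * q) - l) - (c - r * q)"
      by (simp add: algebra_simps)
    then show ?thesis using dvd_diff[OF 1(2,1)] by metis
  next
    case 2
    have "(r + s) * q = (c - l) - (c - (l + s * q) - r * q)"
      by (simp add: algebra_simps)
    then show ?thesis using dvd_diff[OF 2] by metis
  next
    case 3
    have "(r + s) * q = (c - l) - (c - r * q) - (- l - s * q)"
      by (simp add: algebra_simps)
    then show ?thesis using dvd_diff[OF dvd_diff[OF 3(3,2)] 3(1)] by metis
  qed
qed

theorem theorem1:
  fixes r n k s q :: nat
  assumes "r \<ge> 1" and "n \<ge> 1" and "k \<ge> 1" and "s \<ge> 1" and "q \<ge> 1"
    and "gcd n 6 = 1"
    and "r \<ge> s"
    and "perfect_group (Prishchepov_group r n k s q)"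
  shows "trivially_perfect r n k s q \<or> type_Z_tilde r n k s q"
proof -
  define N where "N = int n"
  have N: "N > 0"
    using assms(2) by (simp add: N_def)
  define l where "l = int (k - 1)"
  have l: "int k = l + 1"
    using assms(3) by (simp add: l_def)
  define f where "f = exponent_vec n (Prishchepov_word r n k s q)"
  have f: "f m = (\<Sum>i<r. delta N (m - int i * int q)) - (\<Sum>i<s. delta N (m - l - int i * int q))" for m
    unfolding f_def exponent_vec_Prishchepov_word[OF assms(2)] N_def l_def
    by (simp add: diff_diff_eq)
  have per_f: "periodic N f"
    unfolding f_def N_def by (rule periodic_exponent_vec)
  obtain u where u: "periodic N u" and fu: "cconv N f u = delta N"
    using unit_if_perfect[OF assms(2) Prishchepov_word_carrier[OF assms(2)]
        assms(8)[unfolded Prishchepov_group_def]]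
    unfolding N_def f_def by blast
  have sum_delta: "(\<Sum>m\<in>{0..<N}. delta N (m - j)) = 1" for j
    by (rule sum_delta_shift[OF N])
  have "(\<Sum>m\<in>{0..<N}. f m) * (\<Sum>m\<in>{0..<N}. u m) = 1"
    by (rule augmentation_unit[OF N u fu])
  moreover have "(\<Sum>m\<in>{0..<N}. f m) = int r - int s"
    unfolding f sum_subtractf
    by (subst (1 2) sum.swap) (use sum_delta in \<open>simp add: diff_diff_eq\<close>)
  ultimately have rs: "int r = int s + 1"
    using assms(7) by (auto simp: zmult_eq_1_iff)
  obtain j where j: "\<And>m. f m = f (j - m)"
    using unit_reflect[OF N per_f u fu] by blast
  \<comment> \<open>Multiplication by \<open>1 - t\<^sup>q\<close> collapses the geometric sums.\<close>
  have telescope: "(\<Sum>i<a. delta N (m - int i * int q)) - (\<Sum>i<a. delta N (m - int q - int i * int q))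
      = delta N m - delta N (m - int a * int q)" for a m
  proof -
    have "delta N (m - int q - int i * int q) = delta N (m - int (Suc i) * int q)" for i
      by (simp add: diff_diff_eq distrib_right)
    then show ?thesis
      using sum_lessThan_telescope'[of "\<lambda>i. delta N (m - int i * int q)" a]
      by (simp only: flip: sum_subtractf) simp
  qed
  have g: "f m - f (m - int q) = delta N m - delta N (m - int r * int q) - delta N (m - l)
      + delta N (m - l - int s * int q)" for m
  proof -
    have swap: "m - int q - l = m - l - int q"
      by simp
    show ?thesis
      unfolding f swap using telescope[of m r] telescope[of "m - l" s] by linarith
  qed
  \<comment> \<open>The factor \<open>1 - t\<^sup>q\<close> is itself antisymmetric, with reflection \<open>m \<mapsto> q - m\<close>; hence
    \<open>c = j + q\<close>.\<close>
  have "f m - f (m - int q) = - (f (j + int q - m) - f (j + int q - m - int q))" for m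
  proof -
    have swap: "j + int q - m - int q = j - m" "j - (m - int q) = j + int q - m"
      by simp_all
    show ?thesis
      using j[of m] j[of "m - int q"] unfolding swap by linarith
  qed
  then have anti: "delta N m - delta N (m - int r * int q) - delta N (m - l) + delta N (m - l - int s * int q)
      = - (delta N (j + int q - m) - delta N (j + int q - m - int r * int q)
        - delta N (j + int q - m - l) + delta N (j + int q - m - l - int s * int q))" for m
    unfolding g .
  have gcd_dvd: "[gcd q n * a = 0] (mod n)" if "N dvd int a * int q" for a
  proof -
    have "n dvd a * q"
      using that unfolding N_def by (simp only: int_dvd_int_iff flip: of_nat_mult)
    then have "n dvd gcd (a * q) (a * n)"
      by simp
    then have "n dvd gcd q n * a"
      by (metis gcd_mult_distrib_nat mult.commute)
    then show ?thesis
      by (simp only: cong_0_iff)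
  qed
  have abs_rs: "\<bar>int r - int s\<bar> = 1"
    using rs by simp
  \<comment> \<open>Each cancellation between a positive and a negative term makes the parameters trivially perfect.\<close>
  have "trivially_perfect r n k s q" if "N dvd l"
  proof -
    have "[int k = int 1] (mod int n)"
      using that unfolding cong_iff_dvd_diff N_def l by simp
    then have "[k = 1] (mod n)"
      by (simp only: cong_int_iff)
    then show ?thesis
      using abs_rs unfolding trivially_perfect_def by blast
  qed
  moreover have "trivially_perfect r n k s q" if "N dvd l + int s * int q - int r * int q"
  proof -
    have "l + int s * int q - int r * int q = int k - int (1 + q)"
      unfolding rs l by (simp add: distrib_right)
    then have "[int k = int (1 + q)] (mod int n)"
      using that unfolding cong_iff_dvd_diff N_def by metis
    then have "[k = 1 + q] (mod n)"
      by (simp only: cong_int_iff)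
    then show ?thesis
      using abs_rs unfolding trivially_perfect_def by blast
  qed
  moreover have "trivially_perfect r n k s q" if "N dvd int r * int q \<or> N dvd int s * int q"
    using that abs_rs gcd_dvd unfolding trivially_perfect_def by blast
  moreover have "type_Z_tilde r n k s q" if "N dvd (int r - int s) * int q - 2 * l"
  proof -
    have "(int r - int s) * int q - 2 * l = int q * (int r - int s) - 2 * (int k - 1)"
      by (simp add: l)
    then show ?thesis
      using that unfolding type_Z_tilde_def cong_iff_dvd_diff N_def by metis
  qed
  moreover have "type_Z_tilde r n k s q" if "N dvd (int r + int s) * int q"
  proof -
    have "(int r + int s) * int q = int (q * (r + s))"
      by simp
    then have "n dvd q * (r + s)"
      using that unfolding N_def by (metis int_dvd_int_iff)
    then show ?thesis
      unfolding type_Z_tilde_def cong_0_iff by blast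
  qed
  ultimately show ?thesis
    using antisymmetric_four_term[where r = "int r" and s = "int s", OF anti] by blast
qed

end
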